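(* Let $N\ge 3$. The $N$-tuple $(2,2,\dots,2)\in(\mathbb{Z}/N\mathbb{Z})^N$ is an irreducible solution of $(E_N)$.
   Context: For $a_1,\dots,a_n\in\mathbb{Z}/N\mathbb{Z}$ set $M_n(a_1,\dots,a_n)=\begin{pmatrix}a_n&-1\\1&0\end{pmatrix}\cdots\begin{pmatrix}a_1&-1\\1&0\end{pmatrix}$. An $n$-tuple is a solution of $(E_N)$ if $M_n(a_1,\dots,a_n)=\pm\mathrm{Id}$ over $\mathbb{Z}/N\mathbb{Z}$. The sum of $(a_1,\dots,a_n)$ and $(b_1,\dots,b_m)$ is $(a_1+b_m,a_2,\dots,a_{n-1},a_n+b_1,b_2,\dots,b_{m-1})$. Two $n$-tuples are equivalent ($\sim$) if one is a cyclic permutation of the other or of its reversal. A solution $(c_1,\dots,c_n)$ with $n\ge3$ is reducible if there exist solutions $(a_1,\dots,a_m)$, $(b_1,\dots,b_l)$ with $m,l\ge3$ and $(c_1,\dots,c_n)\sim(a_1,\dots,a_m)\oplus(b_1,\dots,b_l)$; a solution of size $\ge3$ is irreducible if it is not reducible. *)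

theory Defs
  imports "HOL-Analysis.Cartesian_Space" "Berlekamp_Zassenhaus.Finite_Field"
begin

text \<open>
  The ring of integers modulo \<open>N\<close> is the type \<open>'n mod_ring\<close>, where \<open>N = CARD('n)\<close>; the sort
  \<open>nontriv\<close> says \<open>N > 1\<close>.  The tuple $(a_1,\dots,a_n)$ is the list \<open>[a\<^sub>1, \<dots>, a\<^sub>n]\<close>.
\<close>

definition elem_mat :: "'a::comm_ring_1 \<Rightarrow> 'a^2^2" where
  "elem_mat a = vector [vector [a, -1], vector [1, 0]]"

text \<open>The factors are in reverse order: the last entry of the tuple gives the leftmost factor.\<close>

fun M :: "'a::comm_ring_1 list \<Rightarrow> 'a^2^2" where
  "M [] = mat 1"
| "M (a # as) = M as ** elem_mat a"

definition is_solution :: "'n::nontriv mod_ring list \<Rightarrow> bool" where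
  "is_solution as \<longleftrightarrow> M as = mat 1 \<or> M as = - mat 1"

text \<open>
  $(a_1 + b_m, a_2, \dots, a_{n-1}, a_n + b_1, b_2, \dots, b_{m-1})$; meaningful only when both
  lists have length at least 2.
\<close>

definition tuple_sum :: "'a::comm_ring_1 list \<Rightarrow> 'a list \<Rightarrow> 'a list" (infixl "\<oplus>\<^sub>t" 65) where
  "as \<oplus>\<^sub>t bs = (hd as + last bs) # butlast (tl as) @ (last as + hd bs) # butlast (tl bs)"

definition tuple_equiv :: "'a list \<Rightarrow> 'a list \<Rightarrow> bool" (infix "\<sim>\<^sub>t" 50) where
  "as \<sim>\<^sub>t bs \<longleftrightarrow> (\<exists>k. as = rotate k bs \<or> as = rotate k (rev bs))"

definition reducible :: "'n::nontriv mod_ring list \<Rightarrow> bool" where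
  "reducible cs \<longleftrightarrow> is_solution cs \<and> length cs \<ge> 3 \<and>
     (\<exists>as bs. is_solution as \<and> is_solution bs \<and> length as \<ge> 3 \<and> length bs \<ge> 3 \<and>
              cs \<sim>\<^sub>t as \<oplus>\<^sub>t bs)"

definition irreducible_solution :: "'n::nontriv mod_ring list \<Rightarrow> bool" where
  "irreducible_solution cs \<longleftrightarrow> is_solution cs \<and> length cs \<ge> 3 \<and> \<not> reducible cs"

end

theory Submission
  imports Defs
begin

text \<open>
  The product over $k$ twos has rows $(k+1,-k)$ and $(k,1-k)$, so it is the identity for $k=N$.
  If $(2,\dots,2)$ is a sum, then its first summand is $(x,2,\dots,2,y)$ with $1\le k\le N-3$ twos.
  The lower right entry of its product is $-(k+1)$, independently of $x$ and $y$, so a solution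
  would require $k+1\equiv\pm1$ modulo $N$.
\<close>

lemma elem_mat_nth [simp]:
  "elem_mat a $ 1 $ 1 = a" "elem_mat a $ 1 $ 2 = -1"
  "elem_mat a $ 2 $ 1 = 1" "elem_mat a $ 2 $ 2 = 0"
  by (simp_all add: elem_mat_def vector_def)

lemma M_append: "M (as @ bs) = M bs ** M as"
  by (induction as) (simp_all add: matrix_mul_assoc)

text \<open>\<open>elem_mat 2\<close> is the identity plus a matrix with both rows $(1,-1)$, whose
  square is zero; hence its powers are linear in \<open>k\<close>. Column 1 of each product mixes
  both entries of a row, so the entries share one induction.\<close>

lemma M_replicate_2_nth:
  fixes k :: nat
  defines "P \<equiv> M (replicate k (2 :: 'a::comm_ring_1))"
  shows "P $ 1 $ 1 = of_nat k + 1" "P $ 1 $ 2 = - of_nat k"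
    "P $ 2 $ 1 = of_nat k" "P $ 2 $ 2 = 1 - of_nat k"
  unfolding P_def
  by (induction k)
    (simp_all add: matrix_matrix_mult_def mat_def sum_2 algebra_simps)

text \<open>Row 2 of \<open>elem_mat y\<close> is $(1,0)$ and column 2 of \<open>elem_mat x\<close>
  is $(-1,0)$, so neither \<open>x\<close> nor \<open>y\<close> enters.\<close>

lemma M_pad_nth_2_2: "M (x # as @ [y]) $ 2 $ 2 = - M as $ 1 $ 1"
  by (simp add: M_append matrix_matrix_mult_def sum_2 mat_def)

lemma is_solution_replicate_2:
  "is_solution (replicate CARD('n) (2 :: 'n::nontriv mod_ring))"
proof -
  have "M (replicate CARD('n) (2 :: 'n mod_ring)) = mat 1"
    by (simp add: vec_eq_iff forall_2 M_replicate_2_nth mat_def)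
  then show ?thesis
    by (simp add: is_solution_def)
qed

text \<open>Rotation and reversal preserve length and set of entries, which determine a constant
  list.\<close>

lemma tuple_equiv_replicateD:
  assumes "replicate n x \<sim>\<^sub>t cs"
  shows "cs = replicate n x"
proof -
  have "length cs = n" "set cs = set (replicate n x)"
    using assms unfolding tuple_equiv_def
    by (metis length_replicate length_rev length_rotate, metis set_rev set_rotate)
  then show ?thesis
    by (metis in_set_replicate replicate_eqI)
qed

lemma length_tuple_sum:
  assumes "length as \<ge> 2" "length bs \<ge> 2"
  shows "length (as \<oplus>\<^sub>t bs) = length as + length bs - 2"
  using assms by (simp add: tuple_sum_def)

text \<open>The sum alters only the two end entries of \<open>as\<close>; its inner entries reappear
  unchanged.\<close>

lemma tuple_sum_eq_replicateD:
  assumes sum: "as \<oplus>\<^sub>t bs = replicate n c" and "length as \<ge> 2"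
  obtains x y where "as = x # replicate (length as - 2) c @ [y]"
proof -
  have as: "as = hd as # butlast (tl as) @ [last as]"
    using \<open>length as \<ge> 2\<close> by (cases as; cases "tl as" rule: rev_cases) auto
  have "set (butlast (tl as)) \<subseteq> set (as \<oplus>\<^sub>t bs)"
    by (auto simp: tuple_sum_def)
  then have "butlast (tl as) = replicate (length as - 2) c"
    using sum by (intro replicate_eqI) auto
  with as that show thesis
    by metis
qed

lemma mat_nth_2_2: "mat a $ (2::2) $ 2 = a"
  by (simp add: mat_def)

lemma not_is_solution_padded_2:
  fixes x y :: "'n::nontriv mod_ring"
  assumes "1 \<le> k" "k + 3 \<le> CARD('n)"
  shows "\<not> is_solution (x # replicate k 2 @ [y])"
proof
  assume "is_solution (x # replicate k 2 @ [y])"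
  then have "- (of_nat k + 1 :: 'n mod_ring) = 1 \<or> - (of_nat k + 1 :: 'n mod_ring) = - 1"
    using M_pad_nth_2_2[of x "replicate k 2" y]
    unfolding is_solution_def M_replicate_2_nth by (metis mat_nth_2_2 vector_uminus_component)
  \<comment> \<open>The value 1 gives the first case, the value -1 the second.\<close>
  then have "of_nat (k + 2) = (0 :: 'n mod_ring) \<or> of_nat k = (0 :: 'n mod_ring)"
    by (auto simp: minus_equation_iff add_eq_0_iff algebra_simps)
  then have "CARD('n) dvd k + 2 \<or> CARD('n) dvd k"
    by (simp only: of_nat_eq_0_iff_char_dvd semiring_char_mod_ring)
  \<comment> \<open>Both \<open>k\<close> and \<open>k + 2\<close> lie strictly between 0 and the
    modulus.\<close>
  with assms show False
    by (auto dest!: dvd_imp_le)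
qed

theorem theorem2p6:
  fixes N :: nat
  assumes "N = CARD('n::nontriv)" and "N \<ge> 3"
  shows "irreducible_solution (replicate N (2 :: 'n mod_ring))"
proof -
  have "\<not> reducible (replicate N (2 :: 'n mod_ring))"
  proof
    assume "reducible (replicate N (2 :: 'n mod_ring))"
    then obtain as bs where sol: "is_solution as" and len: "length as \<ge> 3" "length bs \<ge> 3"
      and eq: "replicate N (2 :: 'n mod_ring) \<sim>\<^sub>t as \<oplus>\<^sub>t bs"
      unfolding reducible_def by blast
    from tuple_equiv_replicateD[OF eq]
    have sum: "as \<oplus>\<^sub>t bs = replicate N 2" .
    then have N: "N = length as + length bs - 2"
      using length_tuple_sum[of as bs] len by simp
    obtain x y where "as = x # replicate (length as - 2) 2 @ [y]"
      using tuple_sum_eq_replicateD[OF sum] len by auto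
    \<comment> \<open>Here \<open>length as - 2 = N - length bs\<close>, so the upper bound comes
      from \<open>length bs \<ge> 3\<close>.\<close>
    moreover have "1 \<le> length as - 2" "length as - 2 + 3 \<le> CARD('n)"
      using len N assms(1) by linarith+
    ultimately show False
      using not_is_solution_padded_2 sol by metis
  qed
  then show ?thesis
    using is_solution_replicate_2 assms by (simp add: irreducible_solution_def)
qed

end
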